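(* Let $N,s$ be integers with $0\le s\le N$, and let $$P(z)=\sum_{j=0}^{s}(-1)^j\gamma_j\left(z^j-z^{N+s+1-j}\right),\qquad \gamma_0=1,$$ where $\gamma_1,\dots,\gamma_s$ are real numbers. If all zeros of $P(z)$ are located on the unit circle $\{z\in\mathbb{C}:|z|=1\}$, then $$|\gamma_j|\le \binom{s}{j}\binom{N+s+1}{j}\binom{N}{j}^{-1},\qquad j=1,\dots,s.$$ Moreover, these estimates cannot be improved in general: for given $N,s$ and each $j\in\{1,\dots,s\}$, the constant $\binom{s}{j}\binom{N+s+1}{j}\binom{N}{j}^{-1}$ cannot be replaced by a smaller one in the bound on $|\gamma_j|$ valid for all polynomials $P$ of the form $P(z)=\sum_{k=0}^{s}(-1)^k\gamma_k\left(z^k-z^{N+s+1-k}\right)$ with $\gamma_0=1$ and $\gamma_1,\dots,\gamma_s$ real, having all their zeros on the unit circle. *)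

theory Defs
  imports Complex_Main "HOL-Computational_Algebra.Polynomial"
begin

text \<open>Only the values \<open>\<gamma> 0, \<dots>, \<gamma> s\<close> matter; the normalisation \<open>\<gamma> 0 = 1\<close> is
  imposed separately.\<close>

definition P_poly :: "nat \<Rightarrow> nat \<Rightarrow> (nat \<Rightarrow> real) \<Rightarrow> complex poly" where
  "P_poly N s \<gamma> =
     (\<Sum>j=0..s. smult ((-1) ^ j * of_real (\<gamma> j)) (monom 1 j - monom 1 (N + s + 1 - j)))"

definition zeros_on_unit_circle :: "complex poly \<Rightarrow> bool" where
  "zeros_on_unit_circle p \<longleftrightarrow> (\<forall>z. poly p z = 0 \<longrightarrow> cmod z = 1)"

definition coeff_bound :: "nat \<Rightarrow> nat \<Rightarrow> nat \<Rightarrow> real" where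
  "coeff_bound N s j =
     real (s choose j) * real ((N + s + 1) choose j) * inverse (real (N choose j))"

end

theory Submission
  imports Defs "HOL-Computational_Algebra.Fundamental_Theorem_Algebra"
begin

text \<open>
  The bound. The coefficients of \<open>P\<close>, which has degree \<open>n = N + s + 1\<close>, vanish strictly between
  \<open>s\<close> and \<open>N + 1\<close>, so differentiating \<open>s + 1\<close> times wipes out the lower block and leaves
  \<open>z ^ (N - s) * q z\<close> with \<open>degree q = s\<close>. By the Gauss-Lucas principle
  (\<open>higher_pderiv_roots_in_disc\<close>) the zeros of \<open>q\<close> lie in the closed unit disc, hence the
  coefficients of \<open>q\<close> are at most those of \<open>(z + 1) ^ s\<close> times the leading one
  (\<open>coeff_le_binomial_lead_coeff\<close>). Undoing the factorials produced by the differentiation turns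
  this into the claimed bound on \<open>\<gamma> j\<close>.

  Sharpness. Equality holds for all \<open>j\<close> at once when \<open>q\<close> is a multiple of \<open>(z - 1) ^ s\<close>, which
  means \<open>\<gamma> j = coeff_bound N s j\<close>. What has to be shown is that this candidate
  has all its zeros on the unit circle. Up to a constant it is
  \<open>(z - 1) ^ (2 * s + 1) * R z\<close>, where \<open>R\<close> is the Gegenbauer polynomial \<open>C\<close> of degree \<open>N - s\<close>
  and parameter \<open>s + 1\<close> transplanted to the unit circle by \<open>x = cos (\<theta> / 2)\<close>
  (\<open>P_poly_coeff_bound_factor\<close>). Gegenbauer polynomials of parameter \<open>s + 2\<close> are derivatives of
  those of parameter \<open>s + 1\<close>, and on the circle differentiation is the operator
  \<open>p \<mapsto> 2 z p' - m p\<close>, which keeps all zeros on the circle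
  (\<open>zeros_on_unit_circle_circ_deriv\<close>); the starting point \<open>s = 0\<close> is
  \<open>1 + z + \<dots> + z ^ N\<close>. The factorisation itself is an induction on \<open>s\<close>: one first-order operator,
  \<open>raise_order\<close>, carries both sides from \<open>s\<close> to \<open>s + 1\<close>.

  Both halves rest on one estimate for \<open>z p' / p\<close>, the sum of \<open>z / (z - a)\<close> over the roots \<open>a\<close>:
  each term has real part above or below \<open>1 / 2\<close> according as \<open>a\<close> is nearer to the origin than
  \<open>z\<close> or farther away.
\<close>

section \<open>The logarithmic derivative of a complex polynomial\<close>

text \<open>For \<open>z \<noteq> 0\<close> the map \<open>a \<mapsto> z / (z - a)\<close> sends the disc of radius \<open>cmod z\<close> onto the half plane of real part
  above \<open>1 / 2\<close>, and the exterior to the opposite half plane.\<close>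

lemma Re_self_div_diff_gt_half:
  fixes z a :: complex
  assumes "cmod a < cmod z"
  shows "Re (z / (z - a)) > 1 / 2"
proof -
  define num den where "num = Re z * Re (z - a) + Im z * Im (z - a)"
    and "den = (Re (z - a))\<^sup>2 + (Im (z - a))\<^sup>2"
  have "z \<noteq> a" using assms by auto
  then have "den > 0"
    unfolding den_def by (metis cmod_power2 eq_iff_diff_eq_0 zero_less_norm_iff zero_less_power)
  moreover have "(cmod a)\<^sup>2 < (cmod z)\<^sup>2"
    using assms by (simp add: power_strict_mono)
  then have "den < 2 * num"
    unfolding cmod_power2 by (simp add: num_def den_def power2_eq_square algebra_simps)
  ultimately have "num / den > 1 / 2" by (simp add: field_simps)
  then show ?thesis by (simp add: Re_divide num_def den_def)
qed

lemma Re_self_div_diff_lt_half: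
  fixes z a :: complex
  assumes "cmod z < cmod a"
  shows "Re (z / (z - a)) < 1 / 2"
proof -
  have "z \<noteq> a" using assms by auto
  then have "z / (z - a) = 1 - a / (a - z)" by (simp add: field_simps)
  then show ?thesis using Re_self_div_diff_gt_half[OF assms] by simp
qed

lemma log_deriv_eq_sum_over_roots:
  fixes A :: "complex multiset"
  assumes "z \<notin># A"
  shows "poly (pderiv (\<Prod>x\<in>#A. [:- x, 1:])) z / poly (\<Prod>x\<in>#A. [:- x, 1:]) z
           = (\<Sum>x\<in>#A. 1 / (z - x))"
  using assms
proof (induction A)
  case empty
  then show ?case by simp
next
  case (add a A)
  have "poly (\<Prod>x\<in>#A. [:- x, 1:]) z \<noteq> 0"
    using add.prems by (auto simp: poly_prod_mset prod_mset_zero_iff)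
  moreover have "poly (pderiv ([:- a, 1:] * q)) z = poly q z + (z - a) * poly (pderiv q) z" for q
    by (simp add: pderiv_mult pderiv_pCons del: mult_pCons_left)
  ultimately show ?case using add
    by (simp add: add_divide_distrib del: mult_pCons_left)
qed

lemma log_deriv_eq_sum_over_proots:
  fixes p :: "complex poly"
  assumes "poly p z \<noteq> 0"
  shows "z * poly (pderiv p) z / poly p z = (\<Sum>x\<in>#proots p. z / (z - x))"
proof -
  define q where "q = (\<Prod>x\<in>#proots p. [:- x, 1:])"
  have p: "p = smult (lead_coeff p) q" and "p \<noteq> 0"
    using assms by (auto simp: q_def complex_poly_decompose_multiset)
  then have "poly (pderiv p) z / poly p z = poly (pderiv q) z / poly q z"
    by (metis leading_coeff_0_iff mult_divide_mult_cancel_left pderiv_smult poly_smult)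
  also have "\<dots> = (\<Sum>x\<in>#proots p. 1 / (z - x))"
    unfolding q_def by (rule log_deriv_eq_sum_over_roots) (use assms \<open>p \<noteq> 0\<close> in simp)
  finally have "z * (poly (pderiv p) z / poly p z) = z * (\<Sum>x\<in>#proots p. 1 / (z - x))"
    by simp
  then show ?thesis by (simp add: sum_mset_distrib_left)
qed

lemma sum_mset_greater_size:
  fixes f :: "'a \<Rightarrow> complex" and c :: real
  assumes "A \<noteq> {#}" and "\<And>x. x \<in># A \<Longrightarrow> Re (f x) > c"
  shows "Re (\<Sum>x\<in>#A. f x) > size A * c"
  using assms
proof (induction A)
  case (add a A)
  then show ?case by (cases "A = {#}") (fastforce simp: algebra_simps)+
qed simp

lemma sum_mset_less_size:
  fixes f :: "'a \<Rightarrow> complex" and c :: real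
  assumes "A \<noteq> {#}" and "\<And>x. x \<in># A \<Longrightarrow> Re (f x) < c"
  shows "Re (\<Sum>x\<in>#A. f x) < size A * c"
  using assms
proof (induction A)
  case (add a A)
  then show ?case by (cases "A = {#}") (fastforce simp: algebra_simps)+
qed simp

lemma log_deriv_outside_roots:
  fixes p :: "complex poly"
  assumes "degree p > 0" and "\<And>a. poly p a = 0 \<Longrightarrow> cmod a < cmod z"
  shows "Re (z * poly (pderiv p) z / poly p z) > degree p / 2"
proof -
  have "p \<noteq> 0" "poly p z \<noteq> 0" "proots p \<noteq> {#}"
    using assms size_proots_complex[of p] by auto
  moreover from this have "Re (z / (z - x)) > 1 / 2" if "x \<in># proots p" for x
    using Re_self_div_diff_gt_half that assms(2) by simp
  ultimately show ?thesis
    using sum_mset_greater_size[of "proots p" "1 / 2" "\<lambda>x. z / (z - x)"]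
    unfolding log_deriv_eq_sum_over_proots[OF \<open>poly p z \<noteq> 0\<close>] size_proots_complex by simp
qed

lemma log_deriv_inside_roots:
  fixes p :: "complex poly"
  assumes "degree p > 0" and "\<And>a. poly p a = 0 \<Longrightarrow> cmod z < cmod a"
  shows "Re (z * poly (pderiv p) z / poly p z) < degree p / 2"
proof -
  have "p \<noteq> 0" "poly p z \<noteq> 0" "proots p \<noteq> {#}"
    using assms size_proots_complex[of p] by auto
  moreover from this have "Re (z / (z - x)) < 1 / 2" if "x \<in># proots p" for x
    using Re_self_div_diff_lt_half that assms(2) by simp
  ultimately show ?thesis
    using sum_mset_less_size[of "proots p" "\<lambda>x. z / (z - x)" "1 / 2"]
    unfolding log_deriv_eq_sum_over_proots[OF \<open>poly p z \<noteq> 0\<close>] size_proots_complex by simp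
qed

section \<open>Polynomials with all zeros in the unit disc\<close>

text \<open>The Gauss-Lucas theorem for the unit disc: a zero of \<open>p'\<close> outside the disc would make
  the logarithmic derivative vanish there, although its product with \<open>z\<close> has positive real part.\<close>

lemma higher_pderiv_roots_in_disc:
  fixes p :: "complex poly"
  assumes "\<And>a. poly p a = 0 \<Longrightarrow> cmod a \<le> 1" and "k \<le> degree p" "poly ((pderiv ^^ k) p) z = 0"
  shows "cmod z \<le> 1"
  using assms(2,3)
proof (induction k arbitrary: z)
  case 0
  then show ?case using assms(1) by simp
next
  case (Suc k)
  show ?case
  proof (rule ccontr)
    assume "\<not> cmod z \<le> 1"
    then have z: "cmod z > 1" by simp
    have deg: "degree ((pderiv ^^ k) p) > 0" using Suc.prems by (simp add: degree_higher_pderiv)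
    have "Re (z * poly (pderiv ((pderiv ^^ k) p)) z / poly ((pderiv ^^ k) p) z) > 0"
      using log_deriv_outside_roots[OF deg, of z] Suc z deg by fastforce
    then show False using Suc.prems by simp
  qed
qed

text \<open>The coefficients are dominated by those of \<open>(1 + z) ^ size A\<close>; multiplying by one more factor
  is Pascal's rule.\<close>

lemma coeff_prod_linear_factors_le_binomial:
  fixes A :: "complex multiset"
  assumes "\<And>a. a \<in># A \<Longrightarrow> cmod a \<le> 1"
  shows "cmod (coeff (\<Prod>x\<in>#A. [:- x, 1:]) k) \<le> size A choose k"
  using assms
proof (induction A arbitrary: k)
  case empty
  then show ?case by (simp add: coeff_1)
next
  case (add a A)
  define q where "q = (\<Prod>x\<in>#A. [:- x, 1:])"
  have IH: "cmod (coeff q i) \<le> size A choose i" for i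
    unfolding q_def using add by simp
  have a: "cmod (a * coeff q i) \<le> size A choose i" for i
    using mult_mono[OF add.prems[of a] IH[of i]] by (simp add: norm_mult)
  show ?case
  proof (cases k)
    case 0
    then show ?thesis using a[of 0] by (simp flip: q_def)
  next
    case (Suc i)
    have "cmod (coeff q i - a * coeff q (Suc i)) \<le> cmod (coeff q i) + cmod (a * coeff q (Suc i))"
      by (rule norm_triangle_ineq4)
    also have "\<dots> \<le> (size A choose i) + (size A choose Suc i)"
      using IH[of i] a[of "Suc i"] by simp
    finally show ?thesis using Suc by (simp flip: q_def)
  qed
qed

lemma coeff_le_binomial_lead_coeff:
  fixes p :: "complex poly"
  assumes "\<And>a. poly p a = 0 \<Longrightarrow> cmod a \<le> 1" and "p \<noteq> 0"
  shows "cmod (coeff p k) \<le> (degree p choose k) * cmod (lead_coeff p)"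
proof -
  have "coeff p k = lead_coeff p * coeff (\<Prod>x\<in>#proots p. [:- x, 1:]) k"
    by (metis coeff_smult complex_poly_decompose_multiset)
  moreover have "cmod (coeff (\<Prod>x\<in>#proots p. [:- x, 1:]) k) \<le> degree p choose k"
    using coeff_prod_linear_factors_le_binomial[of "proots p" k] assms
    by (simp add: size_proots_complex)
  ultimately show ?thesis
    by (simp add: norm_mult mult.commute[of "cmod (lead_coeff p)"] mult_right_mono)
qed

section \<open>The coefficient estimate\<close>

lemma coeff_P_poly:
  "coeff (P_poly N s \<gamma>) k =
     (if k \<le> s then (-1) ^ k * of_real (\<gamma> k) else 0) -
     (if N + 1 \<le> k \<and> k \<le> N + s + 1 then (-1) ^ (N + s + 1 - k) * of_real (\<gamma> (N + s + 1 - k)) else 0)"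
proof -
  let ?f = "\<lambda>j. (-1) ^ j * complex_of_real (\<gamma> j)"
  have "coeff (P_poly N s \<gamma>) k =
      (\<Sum>j=0..s. (if j = k then ?f j else 0)) - (\<Sum>j=0..s. (if N + s + 1 - j = k then ?f j else 0))"
    unfolding P_poly_def coeff_sum sum_subtractf[symmetric] by (intro sum.cong) auto
  also have "(\<Sum>j=0..s. (if N + s + 1 - j = k then ?f j else 0)) =
      (\<Sum>j=0..s. (if j = N + s + 1 - k \<and> N + 1 \<le> k \<and> k \<le> N + s + 1 then ?f j else 0))"
    by (intro sum.cong) auto
  also have "\<dots> = (if N + 1 \<le> k \<and> k \<le> N + s + 1 then ?f (N + s + 1 - k) else 0)"
    by (cases "N + 1 \<le> k \<and> k \<le> N + s + 1") auto
  finally show ?thesis by simp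
qed

text \<open>The quotients of factorials are what \<open>s + 1\<close> differentiations put in front of
  \<open>z ^ (N + s + 1 - j)\<close> and of the leading term.\<close>

lemma coeff_bound_eq_fact:
  assumes "j \<le> s" "s \<le> N"
  shows "coeff_bound N s j * (fact (N + s + 1 - j) / fact (N - j))
           = (s choose j) * (fact (N + s + 1) / fact N)"
proof -
  have "real (N + s + 1 choose j) = fact (N + s + 1) / (fact j * fact (N + s + 1 - j))"
       "real (N choose j) = fact N / (fact j * fact (N - j))"
    using assms by (simp_all add: binomial_fact)
  then show ?thesis by (simp add: coeff_bound_def del: fact_Suc)
qed

text \<open>The \<open>(s + 1)\<close>-st derivative of \<open>P\<close> retains only the upper block of coefficients, so after removal
  of a power of \<open>z\<close> it has degree \<open>s\<close> and carries the binomial bound of polynomials with zeros in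
  the disc.\<close>

lemma abs_coeff_le_coeff_bound:
  assumes "s \<le> N" "\<gamma> 0 = 1" "zeros_on_unit_circle (P_poly N s \<gamma>)" "j \<le> s"
  shows "\<bar>\<gamma> j\<bar> \<le> coeff_bound N s j"
proof -
  define P where "P = P_poly N s \<gamma>"
  define Q where "Q = (pderiv ^^ (s + 1)) P"
  define q where "q = poly_shift (N - s) Q"
  have coeff_P: "coeff P k = (if k \<le> s then (-1) ^ k * of_real (\<gamma> k) else 0) -
     (if N + 1 \<le> k \<and> k \<le> N + s + 1 then (-1) ^ (N + s + 1 - k) * of_real (\<gamma> (N + s + 1 - k)) else 0)" for k
    unfolding P_def by (rule coeff_P_poly)
  have deg_P: "degree P = N + s + 1"
  proof (rule antisym)
    show "degree P \<le> N + s + 1" using \<open>s \<le> N\<close> by (intro degree_le) (simp add: coeff_P)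
    show "N + s + 1 \<le> degree P" using assms by (intro le_degree) (simp add: coeff_P)
  qed
  have coeff_Q: "coeff Q k = pochhammer (of_nat (Suc k)) (s + 1) * coeff P (k + (s + 1))" for k
    unfolding Q_def by (rule coeff_higher_pderiv)
  have Q_low: "coeff Q k = 0" if "k < N - s" for k
    using that by (auto simp: coeff_Q coeff_P)
  have deg_Q: "degree Q = N" unfolding Q_def degree_higher_pderiv deg_P by simp
  have Q_q: "Q = monom 1 (N - s) * q"
    by (rule poly_eqI) (auto simp: coeff_monom_mult q_def coeff_poly_shift Q_low)
  have coeff_q: "cmod (coeff q (s - i)) = \<bar>\<gamma> i\<bar> * (fact (N + s + 1 - i) / fact (N - i))"
    if "i \<le> s" for i
  proof -
    have "pochhammer (of_nat (Suc (N - i))) (s + 1) = (fact (N - i + (s + 1)) / fact (N - i) :: complex)"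
      using pochhammer_product'[of "1 :: complex" "N - i" "s + 1"]
      by (simp add: pochhammer_fact[symmetric] nonzero_eq_divide_eq mult.commute del: fact_Suc)
    moreover have "N - i + (s + 1) = N + s + 1 - i" "s - i + (N - s) = N - i"
      using that \<open>s \<le> N\<close> by auto
    moreover have "coeff P (N + s + 1 - i) = - ((-1) ^ i * of_real (\<gamma> i))"
      using that \<open>s \<le> N\<close> by (auto simp: coeff_P)
    ultimately show ?thesis
      unfolding q_def coeff_poly_shift coeff_Q
      by (simp only:) (simp add: norm_mult norm_divide norm_power norm_fact del: fact_Suc)
  qed
  have "coeff q s \<noteq> 0" using coeff_q[of 0] assms by auto
  then have "q \<noteq> 0" by auto
  then have deg_q: "degree q = s"
    using deg_Q Q_q \<open>s \<le> N\<close> by (simp add: degree_mult_eq degree_monom_eq)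
  have "cmod z \<le> 1" if "poly q z = 0" for z
  proof (rule higher_pderiv_roots_in_disc[of P "s + 1"])
    have "poly Q z = 0" using that by (simp add: Q_q)
    then show "poly ((pderiv ^^ (s + 1)) P) z = 0" unfolding Q_def .
  qed (use assms deg_P in \<open>auto simp: P_def zeros_on_unit_circle_def\<close>)
  then have "cmod (coeff q (s - j)) \<le> (s choose (s - j)) * cmod (coeff q (s - 0))"
    using coeff_le_binomial_lead_coeff[of q "s - j"] \<open>q \<noteq> 0\<close> by (simp add: deg_q)
  also have "\<dots> = (s choose j) * (fact (N + s + 1) / fact N)"
    using coeff_q[of 0] assms by (simp add: binomial_symmetric[of j s] del: fact_Suc)
  also have "\<dots> = coeff_bound N s j * (fact (N + s + 1 - j) / fact (N - j))"
    using coeff_bound_eq_fact[OF \<open>j \<le> s\<close> \<open>s \<le> N\<close>] by simp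
  finally show ?thesis
    using coeff_q[OF \<open>j \<le> s\<close>] by (simp add: field_simps del: fact_Suc)
qed

section \<open>Differentiation along the unit circle\<close>

text \<open>If \<open>p\<close> at \<open>exp (\<i> * \<theta>)\<close> is \<open>exp (\<i> * m * \<theta> / 2) * f \<theta>\<close>, then \<open>circ_deriv m p\<close> at
  the same point is \<open>-2 * \<i> * exp (\<i> * m * \<theta> / 2) * f' \<theta>\<close>. When \<open>p\<close> is palindromic of degree
  \<open>m\<close> with real coefficients, \<open>f\<close> is a real trigonometric sum and this is its real derivative.\<close>

definition circ_deriv :: "nat \<Rightarrow> complex poly \<Rightarrow> complex poly" where
  "circ_deriv m p = smult 2 (pCons 0 (pderiv p)) - smult (of_nat m) p"

lemma coeff_circ_deriv: "coeff (circ_deriv m p) k = (2 * of_nat k - of_nat m) * coeff p k"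
  by (cases k) (simp_all add: circ_deriv_def coeff_pderiv algebra_simps)

text \<open>A zero off the circle, where \<open>p\<close> does not vanish, satisfies \<open>z p' / p = degree p / 2\<close>, which
  is the value that the real part misses when every root lies on one side of the circle through
  \<open>z\<close>.\<close>

lemma zeros_on_unit_circle_circ_deriv:
  assumes "zeros_on_unit_circle p" "degree p > 0"
  shows "zeros_on_unit_circle (circ_deriv (degree p) p)"
  unfolding zeros_on_unit_circle_def
proof (intro allI impI, rule ccontr)
  fix z assume zero: "poly (circ_deriv (degree p) p) z = 0" and "cmod z \<noteq> 1"
  then have "poly p z \<noteq> 0" using assms by (auto simp: zeros_on_unit_circle_def)
  then have eq: "z * poly (pderiv p) z / poly p z = of_nat (degree p) / 2"
    using zero by (simp add: circ_deriv_def field_simps)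
  have roots: "cmod a = 1" if "poly p a = 0" for a
    using that assms by (simp add: zeros_on_unit_circle_def)
  consider "cmod z > 1" | "cmod z < 1" using \<open>cmod z \<noteq> 1\<close> by linarith
  then show False
  proof cases
    case 1
    then show False
      using log_deriv_outside_roots[of p z] assms(2) roots eq by simp
  next
    case 2
    then show False
      using log_deriv_inside_roots[of p z] assms(2) roots eq by simp
  qed
qed

section \<open>Gegenbauer polynomials on the unit circle\<close>

text \<open>At \<open>exp (\<i> * \<theta>)\<close> this is \<open>exp (\<i> * m * \<theta> / 2)\<close> times the Gegenbauer polynomial of degree \<open>m\<close>
  and parameter \<open>s + 1\<close> at \<open>cos (\<theta> / 2)\<close>.\<close>

definition gegenbauer_poly :: "nat \<Rightarrow> nat \<Rightarrow> complex poly" where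
  "gegenbauer_poly s m = (\<Sum>k\<le>m. monom (of_nat (((s + k) choose s) * ((s + m - k) choose s))) k)"

lemma coeff_gegenbauer_poly:
  "coeff (gegenbauer_poly s m) k =
     (if k \<le> m then of_nat (((s + k) choose s) * ((s + m - k) choose s)) else 0)"
  by (simp add: gegenbauer_poly_def coeff_sum)

lemma degree_gegenbauer_poly: "degree (gegenbauer_poly s m) = m"
proof (rule antisym)
  show "degree (gegenbauer_poly s m) \<le> m"
    by (intro degree_le) (simp add: coeff_gegenbauer_poly)
  show "m \<le> degree (gegenbauer_poly s m)"
    by (intro le_degree) (simp add: coeff_gegenbauer_poly)
qed

lemma Suc_times_binomial_Suc_lower: "Suc k * (n choose Suc k) = (n - k) * (n choose k)"
  by (simp only: binomial_absorption binomial_absorb_comp)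

text \<open>This is the classical fact that the derivative of the Gegenbauer polynomial of degree \<open>m + 1\<close>
  and parameter \<open>s + 1\<close> is \<open>2 * (s + 1)\<close> times that of degree \<open>m\<close> and parameter \<open>s + 2\<close>; the factor
  \<open>z - 1\<close> comes from the derivative of \<open>cos (\<theta> / 2)\<close>.\<close>

lemma circ_deriv_gegenbauer_poly:
  "circ_deriv (Suc m) (gegenbauer_poly s (Suc m))
     = smult (of_nat (Suc s)) ([:-1, 1:] * gegenbauer_poly (Suc s) m)"
proof (rule poly_eqI)
  fix k
  have up: "of_nat (Suc s + i choose Suc s)
      = of_nat (Suc s + i) * of_nat (s + i choose s) / (of_nat (Suc s) :: complex)" for i
    using arg_cong[OF Suc_times_binomial[of s "s + i"], of "of_nat :: nat \<Rightarrow> complex"]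
    by (simp add: field_simps del: binomial_Suc_Suc of_nat_Suc of_nat_add mult_Suc mult_Suc_right)
  have right: "of_nat (s + i choose Suc s)
      = of_nat i * of_nat (s + i choose s) / (of_nat (Suc s) :: complex)" for i
    using arg_cong[OF Suc_times_binomial_Suc_lower[of s "s + i"], of "of_nat :: nat \<Rightarrow> complex"]
    by (simp add: field_simps del: of_nat_Suc of_nat_add mult_Suc mult_Suc_right)
  show "coeff (circ_deriv (Suc m) (gegenbauer_poly s (Suc m))) k
     = coeff (smult (of_nat (Suc s)) ([:-1, 1:] * gegenbauer_poly (Suc s) m)) k"
  proof (cases k)
    case 0
    then show ?thesis using right[of "Suc m"]
      by (simp add: coeff_circ_deriv coeff_gegenbauer_poly del: binomial_Suc_Suc of_nat_Suc)
  next
    case (Suc i)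
    show ?thesis
    proof (cases "i \<le> m")
      case False
      then show ?thesis using Suc by (simp add: coeff_circ_deriv coeff_gegenbauer_poly)
    next
      case True
      then obtain l where m: "m = i + l" by (auto simp: le_iff_add)
      define a b where "a = (of_nat (s + Suc i choose s) :: complex)"
        and "b = (of_nat (s + l choose s) :: complex)"
      have "coeff (gegenbauer_poly (Suc s) m) (Suc i)
          = of_nat (Suc s + Suc i choose Suc s) * of_nat (s + l choose Suc s)"
        by (cases l) (simp_all add: m coeff_gegenbauer_poly del: binomial_Suc_Suc)
      moreover have "coeff (gegenbauer_poly (Suc s) m) i
          = of_nat (s + Suc i choose Suc s) * of_nat (Suc s + l choose Suc s)"
        by (simp add: m coeff_gegenbauer_poly del: binomial_Suc_Suc)
      ultimately have "coeff (smult (of_nat (Suc s)) ([:-1, 1:] * gegenbauer_poly (Suc s) m)) k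
          = of_nat (Suc s) * (of_nat (Suc i) * a / of_nat (Suc s) * (of_nat (Suc s + l) * b / of_nat (Suc s))
              - of_nat (Suc s + Suc i) * a / of_nat (Suc s) * (of_nat l * b / of_nat (Suc s)))"
        unfolding Suc up right a_def b_def by (simp del: of_nat_Suc of_nat_add binomial_Suc_Suc)
      \<comment> \<open>The identity behind this step is \<open>(i + 1) (s + 1 + l) - (s + i + 2) l = (s + 1) (i + 1 - l)\<close>.\<close>
      also have "\<dots> = (of_nat (Suc i) - of_nat l) * (a * b)"
        by (simp add: divide_simps del: of_nat_Suc) (simp add: algebra_simps)
      also have "\<dots> = coeff (circ_deriv (Suc m) (gegenbauer_poly s (Suc m))) k"
        by (simp add: Suc m coeff_circ_deriv coeff_gegenbauer_poly a_def b_def algebra_simps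
            del: binomial_Suc_Suc)
      finally show ?thesis by simp
    qed
  qed
qed

text \<open>Every one of these polynomials is, up to constants and factors \<open>z - 1\<close>, an iterated derivative along the
  circle of a geometric sum.\<close>

lemma zeros_on_unit_circle_gegenbauer_poly: "zeros_on_unit_circle (gegenbauer_poly s m)"
proof (induction s arbitrary: m)
  case 0
  have "cmod z = 1" if "poly (gegenbauer_poly 0 m) z = 0" for z
  proof -
    have "(\<Sum>k\<le>m. z ^ k) = 0"
      using that by (simp add: gegenbauer_poly_def poly_sum poly_monom)
    then have "z ^ Suc m = 1"
      using one_diff_power_eq[of z "Suc m"] by (simp add: lessThan_Suc_atMost)
    then have "cmod z ^ Suc m = 1 ^ Suc m"
      by (metis norm_power norm_one power_one)
    then show ?thesis by (rule power_eq_imp_eq_base) simp_all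
  qed
  then show ?case by (simp add: zeros_on_unit_circle_def)
next
  case (Suc s)
  have "zeros_on_unit_circle (circ_deriv (Suc m) (gegenbauer_poly s (Suc m)))"
    using zeros_on_unit_circle_circ_deriv[OF Suc, of "Suc m"] by (simp add: degree_gegenbauer_poly)
  then show ?case
    by (simp add: circ_deriv_gegenbauer_poly zeros_on_unit_circle_def)
qed

section \<open>Factorisation of the extremal polynomial\<close>

text \<open>If \<open>p = (z - 1) ^ (2 * s + 1) * r\<close>, this equals \<open>(z - 1) ^ (2 * s + 2) * circ_deriv m r\<close>. Expressing
  it through \<open>p\<close> instead of \<open>r\<close> makes it computable on the coefficients of the extremal
  polynomials. When \<open>circ_deriv m r\<close> vanishes at \<open>1\<close>, the result is divisible by
  \<open>(z - 1) ^ (2 * s + 3)\<close>, as the next extremal polynomial must be.\<close>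

definition raise_order :: "nat \<Rightarrow> nat \<Rightarrow> complex poly \<Rightarrow> complex poly" where
  "raise_order m s p = [:-1, 1:] * circ_deriv m p - smult (of_nat (4 * s + 2)) (pCons 0 p)"

lemma coeff_raise_order_0: "coeff (raise_order m s p) 0 = of_nat m * coeff p 0"
  by (simp add: raise_order_def coeff_circ_deriv)

lemma coeff_raise_order_Suc:
  "coeff (raise_order m s p) (Suc k)
     = (2 * of_nat k - of_nat m - 4 * of_nat s - 2) * coeff p k
       + (of_nat m - 2 * of_nat k - 2) * coeff p (Suc k)"
  by (simp add: raise_order_def coeff_circ_deriv algebra_simps)

lemma raise_order_smult: "raise_order m s (smult c p) = smult c (raise_order m s p)"
  by (rule poly_eqI, rename_tac k, case_tac k)
     (simp_all add: coeff_raise_order_0 coeff_raise_order_Suc algebra_simps)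

lemma raise_order_factor:
  "raise_order m s ([:-1, 1:] ^ (2 * s + 1) * r) = [:-1, 1:] ^ (2 * s + 2) * circ_deriv m r"
proof -
  have pd: "pderiv ([:-1, 1:] ^ (2 * s + 1)) = smult (of_nat (2 * s + 1)) ([:-1, 1 :: complex:] ^ (2 * s))"
    by (simp only: Suc_eq_plus1[symmetric] pderiv_power_Suc) (simp add: pderiv_pCons del: mult_pCons_left)
  have "poly (raise_order m s ([:-1, 1:] ^ (2 * s + 1) * r)) z
      = poly ([:-1, 1:] ^ (2 * s + 2) * circ_deriv m r) z" for z
    unfolding raise_order_def circ_deriv_def pderiv_mult pd
    by (simp add: algebra_simps del: mult_pCons_left mult_pCons_right)
  then show ?thesis by (simp add: poly_eq_poly_eq_iff[symmetric] fun_eq_iff)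
qed

lemma raise_order_gegenbauer_poly:
  "raise_order (Suc m) s ([:-1, 1:] ^ (2 * s + 1) * gegenbauer_poly s (Suc m))
     = smult (of_nat (Suc s)) ([:-1, 1:] ^ (2 * Suc s + 1) * gegenbauer_poly (Suc s) m)"
  unfolding raise_order_factor circ_deriv_gegenbauer_poly
  by (simp add: mult_ac del: mult_pCons_left mult_pCons_right)

text \<open>The contiguity relation of the extremal coefficients. The six binomials with lower index \<open>k + 1\<close> reduce to
  the three with lower index \<open>k\<close>, after which a polynomial identity in \<open>N\<close>, \<open>s\<close> and \<open>k\<close> remains.\<close>

lemma coeff_bound_Suc:
  assumes "s < N"
  shows "(real N - real s) * coeff_bound N (Suc s) (Suc k)
     = (real N + 3 * real s + 2 - 2 * real k) * coeff_bound N s k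
       + (real N - real s - 2 * real k - 2) * coeff_bound N s (Suc k)"
proof (cases "k \<le> s")
  case False
  then show ?thesis by (simp add: coeff_bound_def binomial_eq_0 del: binomial_Suc_Suc)
next
  case True
  define n where "n = N + s + 1"
  define b c d where "b = real (s choose k)" and "c = real (n choose k)" and "d = real (N choose k)"
  define u v where "u = real k + 1" and "v = real N - real k"
  have pos: "u > 0" "v > 0" "d > 0" "k \<le> N" "k \<le> n"
    using True assms by (auto simp: u_def v_def d_def n_def)
  have up: "real (Suc x choose Suc k) = (real x + 1) / u * real (x choose k)" for x
    using arg_cong[OF Suc_times_binomial[of k x], of real]
    by (simp add: u_def field_simps del: binomial_Suc_Suc)
  have right: "real (x choose Suc k) = (real x - real k) / u * real (x choose k)" if "k \<le> x" for x
    using arg_cong[OF Suc_times_binomial_Suc_lower[of k x], of real] that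
    by (simp add: u_def field_simps of_nat_diff)
  have 1: "coeff_bound N (Suc s) (Suc k) = (real s + 1) / u * b * ((real n + 1) / u * c) / (v / u * d)"
    using up[of s] up[of n] right[of N] pos
    by (simp add: coeff_bound_def n_def b_def c_def d_def v_def divide_inverse del: binomial_Suc_Suc)
  have 2: "coeff_bound N s (Suc k)
      = (real s - real k) / u * b * ((real n - real k) / u * c) / (v / u * d)"
    using right[of s] right[of n] right[of N] pos True
    by (simp add: coeff_bound_def n_def b_def c_def d_def v_def divide_inverse del: binomial_Suc_Suc)
  have 3: "coeff_bound N s k = b * c / d"
    by (simp add: coeff_bound_def n_def b_def c_def d_def divide_inverse)
  have cancel: "x * (p / u * b * (q / u * c) / (v / u * d)) = x * p * q / (u * v) * (b * c / d)" for x p q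
    using pos by (simp add: field_simps)
  have "(real N - real s) * (real s + 1) * (real n + 1)
      = (real N + 3 * real s + 2 - 2 * real k) * (u * v)
        + (real N - real s - 2 * real k - 2) * (real s - real k) * (real n - real k)"
    by (simp add: n_def u_def v_def algebra_simps)
  then show ?thesis
    unfolding 1 2 3 cancel using pos by (simp add: add_divide_distrib distrib_right)
qed

text \<open>The upper block of coefficients is the reflected lower block with the opposite sign, and the
  coefficient recursion of \<open>raise_order\<close> is invariant under that reflection; so the contiguity
  relation settles both blocks.\<close>

lemma raise_order_P_poly:
  assumes "s < N"
  shows "raise_order (N - s) s (P_poly N s (coeff_bound N s))
     = smult (of_nat (N - s)) (P_poly N (Suc s) (coeff_bound N (Suc s)))"
proof -
  define e where "e s k = (-1) ^ k * complex_of_real (coeff_bound N s k)" for s k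
  define n where "n = N + s + 1"
  have e_0: "e s 0 = 1" for s by (simp add: e_def coeff_bound_def)
  have e_beyond: "e s k = 0" if "s < k" for s k
    using that by (simp add: e_def coeff_bound_def)
  have e_Suc: "of_nat (N - s) * e (Suc s) (Suc k)
      = (2 * of_nat k - of_nat (N - s) - 4 * of_nat s - 2) * e s k
        + (of_nat (N - s) - 2 * of_nat k - 2) * e s (Suc k)" for k
  proof -
    have "of_nat (N - s) * e (Suc s) (Suc k)
        = - ((-1) ^ k * of_real ((real N - real s) * coeff_bound N (Suc s) (Suc k)))"
      using assms by (simp add: e_def of_nat_diff)
    also have "\<dots> = (2 * of_nat k - of_nat (N - s) - 4 * of_nat s - 2) * e s k
        + (of_nat (N - s) - 2 * of_nat k - 2) * e s (Suc k)"
      unfolding coeff_bound_Suc[OF assms] using assms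
      by (simp add: e_def of_nat_diff algebra_simps)
    finally show ?thesis .
  qed
  \<comment> \<open>As \<open>e s k\<close> vanishes beyond \<open>s\<close>, the two blocks may be extended over all indices, which
    removes the case distinction at \<open>s\<close> and \<open>N + 1\<close>.\<close>
  have coeff_ext: "coeff (P_poly N s (coeff_bound N s)) k
      = e s k - (if k \<le> N + s + 1 then e s (N + s + 1 - k) else 0)" for s k
    using e_beyond[of s k] e_beyond[of s "N + s + 1 - k"] by (auto simp: coeff_P_poly e_def)
  show ?thesis
  proof (rule poly_eqI)
    fix k
    show "coeff (raise_order (N - s) s (P_poly N s (coeff_bound N s))) k
      = coeff (smult (of_nat (N - s)) (P_poly N (Suc s) (coeff_bound N (Suc s)))) k"
    proof (cases k)
      case 0
      then show ?thesis
        using assms by (simp add: coeff_raise_order_0 coeff_ext e_0 e_beyond)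
    next
      case (Suc i)
      consider "i > n" | "i = n" | j where "n = Suc (i + j)"
        by (metis less_imp_Suc_add linorder_neqE_nat)
      then show ?thesis
      proof cases
        case 1
        then show ?thesis
          by (simp add: Suc coeff_raise_order_Suc coeff_ext e_beyond n_def)
      next
        case 2
        then show ?thesis using assms
          by (simp add: Suc coeff_raise_order_Suc coeff_ext e_beyond e_0 n_def of_nat_diff)
      next
        case 3
        have ns: "N + s + 1 = Suc (i + j)" "N + Suc s + 1 = Suc (Suc (i + j))"
          using 3 by (auto simp: n_def)
        have coeffs: "coeff (P_poly N s (coeff_bound N s)) i = e s i - e s (Suc j)"
            "coeff (P_poly N s (coeff_bound N s)) (Suc i) = e s (Suc i) - e s j"
            "coeff (P_poly N (Suc s) (coeff_bound N (Suc s))) (Suc i) = e (Suc s) (Suc i) - e (Suc s) (Suc j)"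
          unfolding coeff_ext ns by (simp_all add: Suc_diff_le)
        have i: "(of_nat i :: complex) = of_nat N + of_nat s - of_nat j"
          using arg_cong[OF ns(1), of "of_nat :: nat \<Rightarrow> complex"] by (simp add: algebra_simps)
        \<comment> \<open>Reflection \<open>i \<mapsto> j\<close> exchanges the two linear factors of the recursion.\<close>
        have "of_nat (N - s) * e (Suc s) (Suc j)
            = (2 * of_nat i - of_nat (N - s) - 4 * of_nat s - 2) * e s (Suc j)
              + (of_nat (N - s) - 2 * of_nat i - 2) * e s j"
          unfolding e_Suc i using assms by (simp add: of_nat_diff algebra_simps)
        then show ?thesis
          using e_Suc[of i]
          unfolding Suc coeff_raise_order_Suc coeff_smult coeffs right_diff_distrib by simp
      qed
    qed
  qed
qed

text \<open>Both sides are transformed by \<open>raise_order\<close> into their successors; the quotient of the constants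
  \<open>N - s\<close> and \<open>s + 1\<close> that appear is the ratio of \<open>N choose Suc s\<close> to \<open>N choose s\<close>.\<close>

lemma P_poly_coeff_bound_factor:
  assumes "s \<le> N"
  shows "smult (- of_nat (N choose s)) (P_poly N s (coeff_bound N s))
     = [:-1, 1:] ^ (2 * s + 1) * gegenbauer_poly s (N - s)"
  using assms
proof (induction s)
  case 0
  show ?case
  proof (rule poly_eqI)
    fix k
    show "coeff (smult (- of_nat (N choose 0)) (P_poly N 0 (coeff_bound N 0))) k
        = coeff ([:-1, 1:] ^ (2 * 0 + 1) * gegenbauer_poly 0 (N - 0)) k"
      by (cases k) (auto simp: coeff_P_poly coeff_gegenbauer_poly coeff_bound_def)
  qed
next
  case (Suc s)
  then have N: "N - s = Suc (N - Suc s)" by simp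
  have c: "of_nat (N choose s) * of_nat (N - s) = of_nat (Suc s) * (of_nat (N choose Suc s) :: complex)"
    using arg_cong[OF Suc_times_binomial_Suc_lower[of s N], of "of_nat :: nat \<Rightarrow> complex"]
    unfolding of_nat_mult by (simp only: mult.commute)
  have "smult (of_nat (Suc s)) ([:-1, 1:] ^ (2 * Suc s + 1) * gegenbauer_poly (Suc s) (N - Suc s))
      = raise_order (N - s) s ([:-1, 1:] ^ (2 * s + 1) * gegenbauer_poly s (N - s))"
    unfolding N raise_order_gegenbauer_poly ..
  also have "\<dots> = raise_order (N - s) s (smult (- of_nat (N choose s)) (P_poly N s (coeff_bound N s)))"
    using Suc by simp
  also have "\<dots> = smult (of_nat (Suc s))
      (smult (- of_nat (N choose Suc s)) (P_poly N (Suc s) (coeff_bound N (Suc s))))"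
    unfolding raise_order_smult raise_order_P_poly[OF Suc_le_lessD[OF Suc.prems]] smult_smult
    by (simp only: mult_minus_left mult_minus_right c)
  finally have "smult (inverse (of_nat (Suc s))) (smult (of_nat (Suc s)) ([:-1, 1:] ^ (2 * Suc s + 1) * gegenbauer_poly (Suc s) (N - Suc s)))
      = smult (inverse (of_nat (Suc s))) (smult (of_nat (Suc s))
      (smult (- of_nat (N choose Suc s)) (P_poly N (Suc s) (coeff_bound N (Suc s)))))"
    by (rule arg_cong)
  then show ?case
    unfolding smult_smult[of "inverse (of_nat (Suc s))"] left_inverse[OF of_nat_neq_0] smult_1_left ..
qed

lemma zeros_on_unit_circle_extremal:
  assumes "s \<le> N"
  shows "zeros_on_unit_circle (P_poly N s (coeff_bound N s))"
  unfolding zeros_on_unit_circle_def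
proof (intro allI impI)
  fix z assume "poly (P_poly N s (coeff_bound N s)) z = 0"
  then have "poly ([:-1, 1:] ^ (2 * s + 1) * gegenbauer_poly s (N - s)) z = 0"
    using arg_cong[OF P_poly_coeff_bound_factor[OF assms], of "\<lambda>p. poly p z"] by simp
  then show "cmod z = 1"
    using zeros_on_unit_circle_gegenbauer_poly[of s "N - s"] by (auto simp: zeros_on_unit_circle_def)
qed

section \<open>The sharp coefficient bound\<close>

theorem theorem4p2:
  fixes N s :: nat
  assumes "s \<le> N"
  shows "(\<forall>\<gamma> :: nat \<Rightarrow> real. \<gamma> 0 = 1 \<longrightarrow> zeros_on_unit_circle (P_poly N s \<gamma>) \<longrightarrow>
            (\<forall>j\<in>{1..s}. \<bar>\<gamma> j\<bar> \<le> coeff_bound N s j)) \<and>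
         (\<forall>j\<in>{1..s}. \<forall>C :: real. C < coeff_bound N s j \<longrightarrow>
            \<not> (\<forall>\<gamma> :: nat \<Rightarrow> real. \<gamma> 0 = 1 \<longrightarrow> zeros_on_unit_circle (P_poly N s \<gamma>) \<longrightarrow>
                 \<bar>\<gamma> j\<bar> \<le> C))"
proof (intro conjI ballI allI impI notI)
  fix \<gamma> :: "nat \<Rightarrow> real" and j
  assume "\<gamma> 0 = 1" "zeros_on_unit_circle (P_poly N s \<gamma>)" "j \<in> {1..s}"
  then show "\<bar>\<gamma> j\<bar> \<le> coeff_bound N s j"
    using abs_coeff_le_coeff_bound[OF assms] by simp
next
  fix j C
  assume "C < coeff_bound N s j"
    and le: "\<forall>\<gamma>. \<gamma> 0 = 1 \<longrightarrow> zeros_on_unit_circle (P_poly N s \<gamma>) \<longrightarrow> \<bar>\<gamma> j\<bar> \<le> C"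
  moreover have "\<bar>coeff_bound N s j\<bar> \<le> C"
    using le[rule_format, of "coeff_bound N s"] zeros_on_unit_circle_extremal[OF assms]
    by (simp add: coeff_bound_def[of _ _ 0])
  ultimately show False by linarith
qed

end
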